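(* For each $N\ge2$, the matrix $S_N$ has the eigenvalues $1,2,\ldots,N$. Moreover, for each $n=1,\ldots,N$, the vector $$\bigl(P_{n-1}^{(N)}(z_{1,N}),\ldots,P_{n-1}^{(N)}(z_{N,N})\bigr)^T$$ is an eigenvector of $S_N$ for the eigenvalue $n$, i.e. $S_N=T_N\cdot\mathrm{diag}(1,2,\ldots,N)\cdot T_N^T$ with the orthogonal matrix $T_N=\bigl(P_{j-1}^{(N)}(z_{i,N})\bigr)_{i,j=1,\ldots,N}$.
   Context: $z_{1,N}>\dots>z_{N,N}$ are the ordered zeros of the Hermite polynomial $H_N$, the Hermite polynomials being orthogonal with respect to the density $e^{-x^2}$ on $\mathbb R$. $S_N=(s_{i,j})_{i,j=1}^N$ is the matrix with $s_{i,i}=1+\sum_{l\ne i}(z_{i,N}-z_{l,N})^{-2}$ and $s_{i,j}=-(z_{i,N}-z_{j,N})^{-2}$ for $i\ne j$. $(P_n^{(N)})_{n=0}^{N-1}$ is the finite sequence of polynomials with $\deg P_n^{(N)}=n$ and positive leading coefficients that are orthogonal with respect to the empirical measure $\mu_N=\frac1N(\delta_{z_{1,N}}+\dots+\delta_{z_{N,N}})$ and normalized by $\sum_{i=1}^N P_n^{(N)}(z_{i,N})^2=1$ for $n=0,\ldots,N-1$. *)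

theory Defs
  imports
    "HOL-Probability.Probability"
    "Jordan_Normal_Form.Char_Poly"
begin

(* For the measures used below all polynomials are integrable, so the totalised
   Bochner integral is the genuine integral. *)
definition orthogonal_polys :: "real measure \<Rightarrow> nat set \<Rightarrow> (nat \<Rightarrow> real poly) \<Rightarrow> bool" where
  "orthogonal_polys M D p \<longleftrightarrow>
     (\<forall>n\<in>D. p n \<noteq> 0 \<and> degree (p n) = n) \<and>
     (\<forall>m\<in>D. \<forall>n\<in>D. m \<noteq> n \<longrightarrow> integral\<^sup>L M (\<lambda>x. poly (p m) x * poly (p n) x) = 0)"

(* The Hermite polynomials up to nonzero scalar factors. Only their zeros matter below, so the
   normalisation (physicists', monic, orthonormal, ...) is left open. *)
definition hermite_polys :: "(nat \<Rightarrow> real poly) \<Rightarrow> bool" where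
  "hermite_polys H \<longleftrightarrow>
     orthogonal_polys (density lborel (\<lambda>x. ennreal (exp (- x\<^sup>2)))) UNIV H"

(* All N-tuples and N x N matrices are indexed from 0: z i is the (i+1)-st largest zero. *)
definition ordered_zeros :: "nat \<Rightarrow> real poly \<Rightarrow> (nat \<Rightarrow> real) \<Rightarrow> bool" where
  "ordered_zeros N p z \<longleftrightarrow>
     (\<forall>i j. i < j \<and> j < N \<longrightarrow> z j < z i) \<and> {x. poly p x = 0} = z ` {..<N}"

definition S_mat :: "nat \<Rightarrow> (nat \<Rightarrow> real) \<Rightarrow> real mat" where
  "S_mat N z = Matrix.mat N N (\<lambda>(i, j).
     if i = j then 1 + (\<Sum>l\<in>{..<N} - {i}. 1 / (z i - z l)\<^sup>2)
     else - (1 / (z i - z j)\<^sup>2))"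

definition empirical_measure :: "nat \<Rightarrow> (nat \<Rightarrow> real) \<Rightarrow> real measure" where
  "empirical_measure N z = measure_pmf (map_pmf z (pmf_of_set {..<N}))"

definition dual_polys :: "nat \<Rightarrow> (nat \<Rightarrow> real) \<Rightarrow> (nat \<Rightarrow> real poly) \<Rightarrow> bool" where
  "dual_polys N z P \<longleftrightarrow>
     orthogonal_polys (empirical_measure N z) {..<N} P \<and>
     (\<forall>n<N. lead_coeff (P n) > 0 \<and> (\<Sum>i<N. (poly (P n) (z i))\<^sup>2) = 1)"

definition T_mat :: "nat \<Rightarrow> (nat \<Rightarrow> real) \<Rightarrow> (nat \<Rightarrow> real poly) \<Rightarrow> real mat" where
  "T_mat N z P = Matrix.mat N N (\<lambda>(i, j). poly (P j) (z i))"

end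

theory Submission
  imports Defs
begin

text \<open>
  On vectors of values \<open>(p (z 0), \<dots>, p (z (N - 1)))\<close> of a polynomial, the matrix acts as
  \<open>p (z i) + (\<Sum>l \<noteq> i. (p (z i) - p (z l)) / (z i - z l)\<^sup>2)\<close>. Write
  \<open>p (z l) = p (z i) + p' (z i) (z l - z i) + (z l - z i)\<^sup>2 q\<close>, where \<open>q\<close> is a polynomial in
  \<open>z i\<close> and \<open>z l\<close> of total degree \<open>deg p - 2\<close>. The second order terms contribute a polynomial in \<open>z i\<close>
  of lower degree than \<open>p\<close>, and the first order terms contribute
  \<open>p' (z i) (\<Sum>l \<noteq> i. 1 / (z i - z l))\<close>. By Stieltjes' electrostatic relation, which restates the
  Hermite differential equation at a zero, that sum is \<open>z i\<close>
  (\<open>hermite_zeros_equilibrium\<close>). Hence the matrix is the restriction to the zeros of a linear operator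
  on polynomials that sends \<open>x ^ n\<close> to \<open>(n + 1) x ^ n\<close> plus lower terms
  (\<open>poly_S_op\<close>, \<open>coeff_S_op\<close>).

  In the Vandermonde basis the matrix is therefore upper triangular with diagonal \<open>1, \<dots>, N\<close>, which
  gives its spectrum. It is also symmetric, and an operator that is symmetric for an
  inner product and triangular for the degree filtration is diagonalised by the orthogonal
  polynomials of that inner product (\<open>orthogonal_poly_eigen_defect_null\<close>). For the inner product
  of the empirical measure this gives the eigenvectors. The same principle, applied to
  \<open>p'' - 2 x p'\<close> and the Gaussian weight, gives the Hermite differential equation
  directly from orthogonality.
\<close>

section \<open>Symmetric operators that preserve the degree filtration\<close>

text \<open>
  Polynomials of degrees \<open>0, \<dots>, n - 1\<close> span all polynomials of degree below \<open>n\<close>. The bound on the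
  degree of \<open>q\<close> is put in terms of coefficients so that \<open>n = 0\<close> covers the zero polynomial.
\<close>
lemma linear_functional_vanishes_below:
  fixes F :: "real poly \<Rightarrow> real"
  assumes add: "\<And>q r. F (q + r) = F q + F r"
    and smult: "\<And>c q. F (Polynomial.smult c q) = c * F q"
    and basis: "\<And>m. m < n \<Longrightarrow> p m \<noteq> 0 \<and> degree (p m) = m \<and> F (p m) = 0"
    and q: "\<And>k. k \<ge> n \<Longrightarrow> poly.coeff q k = 0"
  shows "F q = 0"
  using basis q
proof (induction n arbitrary: q)
  case 0
  hence "q = 0" by (simp add: poly_eq_iff)
  thus ?case using smult[of 0 0] by simp
next
  case (Suc n)
  define c where "c = poly.coeff q n / lead_coeff (p n)"
  have pn: "p n \<noteq> 0" "degree (p n) = n" "F (p n) = 0" using Suc.prems(1)[of n] by auto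
  have "F (q - Polynomial.smult c (p n)) = 0"
  proof (rule Suc.IH)
    fix k assume "n \<le> k"
    then consider "k = n" | "k > n" by linarith
    thus "poly.coeff (q - Polynomial.smult c (p n)) k = 0"
    proof cases
      case 1
      moreover have "poly.coeff (p n) n \<noteq> 0" using pn by (metis leading_coeff_0_iff)
      ultimately show ?thesis using 1 pn(2) by (simp add: c_def)
    next
      case 2
      thus ?thesis using pn Suc.prems(2)[of k] by (simp add: coeff_eq_0)
    qed
  qed (use Suc.prems(1) in auto)
  moreover have "F q = F (q - Polynomial.smult c (p n)) + F (Polynomial.smult c (p n))"
    by (subst add[symmetric]) simp
  ultimately show ?case using pn by (simp add: smult)
qed

text \<open>
  The defect \<open>r\<close> has degree below \<open>n\<close>, because the leading terms cancel, and so has \<open>L r\<close>. Both are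
  therefore orthogonal to \<open>p n\<close>, and symmetry gives
  \<open>E (r * r) = E (p n * L r) - lam n * E (p n * r) = 0\<close>. Positivity of \<open>E\<close> on squares is left to
  the applications, since a Gaussian mean only annihilates \<open>r * r\<close> when \<open>r = 0\<close>, while a finite sum
  over points only forces \<open>r\<close> to vanish at these points.
\<close>
lemma orthogonal_poly_eigen_defect_null:
  fixes E :: "real poly \<Rightarrow> real" and L :: "real poly \<Rightarrow> real poly"
  assumes add: "\<And>q r. E (q + r) = E q + E r"
    and smult: "\<And>c q. E (Polynomial.smult c q) = c * E q"
    and L_degree: "\<And>q. degree (L q) \<le> degree q"
    and L_lead: "\<And>q. poly.coeff (L q) (degree q) = lam (degree q) * lead_coeff q"
    and L_sym: "\<And>q r. E (L q * r) = E (q * L r)"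
    and deg: "\<And>m. m \<le> n \<Longrightarrow> p m \<noteq> 0 \<and> degree (p m) = m"
    and orth: "\<And>m. m < n \<Longrightarrow> E (p n * p m) = 0"
    and r: "r = L (p n) - Polynomial.smult (lam n) (p n)"
  shows "E (r * r) = 0"
proof -
  have pn: "degree (p n) = n" using deg by simp
  have rz: "poly.coeff r k = 0" if "k \<ge> n" for k
  proof (cases "k = n")
    case True
    thus ?thesis using L_lead[of "p n"] pn by (simp add: r)
  next
    case False
    hence "k > n" using that by simp
    thus ?thesis using L_degree[of "p n"] pn by (simp add: r coeff_eq_0)
  qed
  have Lrz: "poly.coeff (L r) k = 0" if "k \<ge> n" for k
  proof (cases "degree r < k")
    case True
    thus ?thesis using L_degree[of r] by (simp add: coeff_eq_0)
  next
    case False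
    hence "r = 0" using rz[of "degree r"] that by simp
    \<comment> \<open>The leading-coefficient rule at the zero polynomial forces \<open>L 0 = 0\<close>.\<close>
    moreover have "L 0 = 0"
      using L_degree[of 0] L_lead[of 0] by (metis coeff_0 degree_0 le_zero_eq leading_coeff_0_iff mult_zero_right)
    ultimately show ?thesis by simp
  qed
  have perp: "E (p n * q) = 0" if "\<And>k. k \<ge> n \<Longrightarrow> poly.coeff q k = 0" for q
    by (rule linear_functional_vanishes_below[where F = "\<lambda>q. E (p n * q)" and p = p and n = n])
      (use that add smult deg orth in \<open>auto simp: algebra_simps\<close>)
  have "L (p n) = r + Polynomial.smult (lam n) (p n)" by (simp add: r)
  hence "L (p n) * r = r * r + Polynomial.smult (lam n) (p n * r)"
    by (metis distrib_right mult_smult_left)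
  hence "E (L (p n) * r) = E (r * r) + lam n * E (p n * r)"
    by (simp add: add smult)
  thus ?thesis using perp[OF rz] perp[OF Lrz] L_sym[of "p n" r] by simp
qed

section \<open>The Hermite differential equation\<close>

abbreviation gauss_measure :: "real measure" where
  "gauss_measure \<equiv> density lborel (\<lambda>x. ennreal (exp (- x\<^sup>2)))"

lemma gauss_moment_even:
  "has_bochner_integral gauss_measure (\<lambda>x. x ^ (2 * k))
     (sqrt pi * (fact (2 * k) / (2 ^ (2 * k) * fact k)))"
proof -
  have "has_bochner_integral lborel (\<lambda>x::real. exp (- x\<^sup>2) * x ^ (2 * k))
     (2 *\<^sub>R (sqrt pi / 2 * (fact (2 * k) / (2 ^ (2 * k) * fact k))))"
    by (rule has_bochner_integral_even_function[OF gaussian_moment_even_pos]) auto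
  thus ?thesis
    by (intro has_bochner_integral_density) auto
qed

lemma gauss_moment_odd:
  "has_bochner_integral gauss_measure (\<lambda>x. x ^ (2 * k + 1)) 0"
proof -
  have "has_bochner_integral lborel (\<lambda>x::real. exp (- x\<^sup>2) * x ^ (2 * k + 1)) 0"
    by (rule has_bochner_integral_odd_function[OF gaussian_moment_odd_pos]) auto
  thus ?thesis
    by (intro has_bochner_integral_density) auto
qed

lemma integrable_gauss_power: "integrable gauss_measure (\<lambda>x. x ^ k)"
proof (cases "even k")
  case True
  then obtain j where "k = 2 * j" by blast
  thus ?thesis using gauss_moment_even[of j] by (auto intro: integrable.intros)
next
  case False
  then obtain j where "k = 2 * j + 1" using oddE by blast
  thus ?thesis using gauss_moment_odd[of j] by (auto intro: integrable.intros)
qed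

lemma integrable_gauss_poly: "integrable gauss_measure (poly p)"
proof -
  have "integrable gauss_measure (\<lambda>x. \<Sum>i\<le>degree p. poly.coeff p i * x ^ i)"
    using integrable_gauss_power by (intro Bochner_Integration.integrable_sum) simp
  thus ?thesis by (simp add: poly_altdef[abs_def])
qed

definition gauss_mean :: "real poly \<Rightarrow> real" where
  "gauss_mean p = integral\<^sup>L gauss_measure (poly p)"

lemma gauss_mean_mult: "gauss_mean (p * q) = integral\<^sup>L gauss_measure (\<lambda>x. poly p x * poly q x)"
proof -
  have "poly (p * q) = (\<lambda>x. poly p x * poly q x)" by auto
  thus ?thesis by (simp add: gauss_mean_def)
qed

lemma gauss_mean_add: "gauss_mean (p + q) = gauss_mean p + gauss_mean q"
proof -
  have "poly (p + q) = (\<lambda>x. poly p x + poly q x)" by auto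
  thus ?thesis using integrable_gauss_poly[of p] integrable_gauss_poly[of q]
    by (simp add: gauss_mean_def)
qed

lemma gauss_mean_smult: "gauss_mean (Polynomial.smult c p) = c * gauss_mean p"
proof -
  have "poly (Polynomial.smult c p) = (\<lambda>x. c * poly p x)" by auto
  thus ?thesis by (simp add: gauss_mean_def)
qed

lemma gauss_mean_diff: "gauss_mean (p - q) = gauss_mean p - gauss_mean q"
  using gauss_mean_add[of p "Polynomial.smult (-1) q"] by (simp only: gauss_mean_smult) simp

lemma gauss_mean_monom: "gauss_mean (Polynomial.monom 1 k) = integral\<^sup>L gauss_measure (\<lambda>x. x ^ k)"
proof -
  have "poly (Polynomial.monom 1 k) = (\<lambda>x::real. x ^ k)" by (auto simp: poly_monom)
  thus ?thesis by (simp add: gauss_mean_def)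
qed

lemma gauss_mean_monom_even:
  "gauss_mean (Polynomial.monom 1 (2 * k)) = sqrt pi * (fact (2 * k) / (2 ^ (2 * k) * fact k))"
  using has_bochner_integral_integral_eq[OF gauss_moment_even[of k]]
  by (simp add: gauss_mean_monom)

lemma gauss_mean_monom_odd: "odd k \<Longrightarrow> gauss_mean (Polynomial.monom 1 k) = 0"
  using has_bochner_integral_integral_eq[OF gauss_moment_odd[of "k div 2"]]
  by (simp add: gauss_mean_monom)

text \<open>
  Gaussian integration by parts. It is checked on monomials, where it says that the moments satisfy
  \<open>2 m\<^bsub>k+1\<^esub> = k m\<^bsub>k-1\<^esub>\<close>, and this can be read off their closed form.
\<close>
lemma gauss_mean_pderiv: "gauss_mean (pderiv p) = 2 * gauss_mean (pCons 0 p)"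
proof -
  define F where "F = (\<lambda>p. gauss_mean (pderiv p - Polynomial.smult 2 (pCons 0 p)))"
  have F: "F p = gauss_mean (pderiv p) - 2 * gauss_mean (pCons 0 p)" for p
    by (simp only: F_def gauss_mean_diff gauss_mean_smult)
  have mon: "F (Polynomial.monom 1 m) = 0" for m
  proof (cases "even m")
    case True
    have "gauss_mean (pderiv (Polynomial.monom 1 m)) = 0"
    proof (cases "m = 0")
      case True
      thus ?thesis using gauss_mean_smult[of 0 0] by (simp add: pderiv_monom)
    next
      case False
      hence "pderiv (Polynomial.monom (1::real) m) = Polynomial.smult (of_nat m) (Polynomial.monom 1 (m - 1))" "odd (m - 1)"
        using True by (auto simp: pderiv_monom smult_monom)
      thus ?thesis by (simp add: gauss_mean_smult gauss_mean_monom_odd)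
    qed
    moreover have "gauss_mean (pCons 0 (Polynomial.monom 1 m)) = 0"
      using gauss_mean_monom_odd[of "Suc m"] True by (simp add: monom_Suc)
    ultimately show ?thesis by (simp add: F)
  next
    case False
    then obtain j where m: "m = 2 * j + 1" using oddE by blast
    have "pderiv (Polynomial.monom (1::real) m) = Polynomial.smult (of_nat m) (Polynomial.monom 1 (2 * j))"
      by (simp add: m pderiv_monom smult_monom)
    moreover have "pCons 0 (Polynomial.monom (1::real) m) = Polynomial.monom 1 (2 * (j + 1))"
      by (simp add: m monom_Suc)
    ultimately have "F (Polynomial.monom 1 m) = of_nat m * gauss_mean (Polynomial.monom 1 (2 * j))
        - 2 * gauss_mean (Polynomial.monom 1 (2 * (j + 1)))"
      by (simp only: F gauss_mean_smult)
    also have "\<dots> = 0"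
      unfolding gauss_mean_monom_even m by (simp add: divide_simps)
    finally show ?thesis .
  qed
  have "F p = 0"
  proof (rule linear_functional_vanishes_below[where p = "Polynomial.monom 1" and n = "Suc (degree p)"])
    show "F (q + r) = F q + F r" for q r
      using gauss_mean_add[of "pCons 0 q" "pCons 0 r"]
      by (simp add: F pderiv_add gauss_mean_add)
    show "F (Polynomial.smult c q) = c * F q" for c q
      using gauss_mean_smult[of c "pCons 0 q"]
      by (simp add: F pderiv_smult gauss_mean_smult algebra_simps)
  qed (use mon in \<open>auto simp: degree_monom_eq coeff_eq_0\<close>)
  thus ?thesis by (simp add: F)
qed

lemma gauss_mean_square_eq_0:
  assumes "gauss_mean (p * p) = 0"
  shows "p = 0"
proof (rule ccontr)
  assume p: "p \<noteq> 0"
  have "AE x in gauss_measure. poly (p * p) x = 0"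
    using assms unfolding gauss_mean_def
    by (subst integral_nonneg_eq_0_iff_AE[symmetric]) (auto intro: integrable_gauss_poly)
  hence "AE x in lborel. poly p x = 0"
    by (subst (asm) AE_density) auto
  moreover have "AE x in lborel. poly p x \<noteq> 0"
  proof (rule AE_I')
    show "{x. poly p x = 0} \<in> null_sets lborel"
      using poly_roots_finite[OF p] by (rule finite_imp_null_set_lborel)
  qed auto
  ultimately have "AE x in (lborel :: real measure). False" by eventually_elim simp
  hence "ae_filter (lborel :: real measure) = bot" by (simp only: eventually_False)
  thus False by (simp add: ae_filter_eq_bot_iff)
qed

text \<open>The Ornstein--Uhlenbeck operator \<open>p'' - 2 x p'\<close> of the Gaussian weight.\<close>
definition hermite_op :: "real poly \<Rightarrow> real poly" where
  "hermite_op p = pderiv (pderiv p) - Polynomial.smult 2 (pCons 0 (pderiv p))"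

lemma coeff_hermite_op:
  "poly.coeff (hermite_op p) k =
     real (k + 1) * real (k + 2) * poly.coeff p (k + 2) - 2 * real k * poly.coeff p k"
  by (cases k) (auto simp: hermite_op_def coeff_pderiv coeff_pCons algebra_simps)

text \<open>
  The Dirichlet form of the operator: its right-hand side is symmetric in \<open>p\<close> and \<open>q\<close>, so
  \<open>hermite_op\<close> is symmetric for the Gaussian inner product.
\<close>
lemma gauss_mean_hermite_op: "gauss_mean (hermite_op p * q) = - gauss_mean (pderiv p * pderiv q)"
proof -
  have "hermite_op p * q = pderiv (pderiv p * q) - Polynomial.smult 2 (pCons 0 (pderiv p * q)) - pderiv p * pderiv q"
    by (simp add: hermite_op_def pderiv_mult algebra_simps)
  thus ?thesis using gauss_mean_pderiv[of "pderiv p * q"]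
    by (simp only: gauss_mean_diff gauss_mean_smult)
qed

text \<open>
  \<open>hermite_op\<close> multiplies the leading coefficient of a polynomial of degree \<open>n\<close> by \<open>- 2 n\<close>, so
  orthogonality alone makes the Hermite polynomials its eigenfunctions.
\<close>
theorem hermite_differential_equation:
  assumes "hermite_polys H"
  shows "hermite_op (H n) = Polynomial.smult (- 2 * real n) (H n)"
proof -
  have deg: "H m \<noteq> 0 \<and> degree (H m) = m" for m
    using assms by (simp add: hermite_polys_def orthogonal_polys_def)
  have orth: "gauss_mean (H n * H m) = 0" if "m < n" for m
    using assms that by (simp add: hermite_polys_def orthogonal_polys_def gauss_mean_mult)
  define r where "r = hermite_op (H n) - Polynomial.smult (- 2 * real n) (H n)"
  have "gauss_mean (r * r) = 0"
  proof (rule orthogonal_poly_eigen_defect_null[where L = hermite_op and p = H and n = n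
        and lam = "\<lambda>k. - 2 * real k", OF gauss_mean_add gauss_mean_smult _ _ _ deg _ r_def])
    show "gauss_mean (H n * H m) = 0" if "m < n" for m using that by (rule orth)
    show "degree (hermite_op q) \<le> degree q" for q
      by (rule degree_le) (simp add: coeff_hermite_op coeff_eq_0)
    show "poly.coeff (hermite_op q) (degree q) = - 2 * real (degree q) * lead_coeff q" for q
      by (simp add: coeff_hermite_op coeff_eq_0)
    show "gauss_mean (hermite_op q * s) = gauss_mean (q * hermite_op s)" for q s
      using gauss_mean_hermite_op[of q s] gauss_mean_hermite_op[of s q] by (simp add: mult.commute)
  qed
  hence "r = 0" by (rule gauss_mean_square_eq_0)
  thus ?thesis by (simp add: r_def)
qed

section \<open>The zeros as an electrostatic equilibrium\<close>

text \<open>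
  Near the simple zero \<open>a\<close>, write \<open>p = (x - a) f\<close>. Then \<open>p' = f\<close> and \<open>p'' = 2 f'\<close> at \<open>a\<close>, and the
  logarithmic derivative \<open>f' / f\<close> is the sum over the other zeros.
\<close>
lemma stieltjes_sum_eq_log_deriv:
  fixes p :: "real poly"
  assumes fin: "finite A"
    and a: "a \<notin> A"
    and p: "p = [:- a, 1:] * Polynomial.smult c (\<Prod>b\<in>A. [:- b, 1:])"
    and c: "c \<noteq> 0"
  shows "poly (pderiv p) a \<noteq> 0"
    and "poly (pderiv (pderiv p)) a = 2 * (\<Sum>b\<in>A. 1 / (a - b)) * poly (pderiv p) a"
proof -
  define g where "g = (\<Prod>b\<in>A. [:- b, 1::real:])"
  have g0: "poly g a \<noteq> 0"
    using fin a by (auto simp: g_def poly_prod)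
  have "poly (pderiv g) a = (\<Sum>b\<in>A. 1 / (a - b)) * poly g a"
    unfolding g_def using fin a
  proof (induction A)
    case (insert b A)
    hence "a - b \<noteq> 0" by auto
    define h where "h = (\<Prod>b\<in>A. [:- b, 1::real:])"
    have IH: "poly (pderiv h) a = (\<Sum>b\<in>A. 1 / (a - b)) * poly h a"
      using insert by (simp add: h_def)
    have "poly (pderiv ([:- b, 1:] * h)) a = (a - b) * poly (pderiv h) a + poly h a"
      by (simp only: pderiv_mult) (simp add: pderiv_pCons algebra_simps)
    also have "\<dots> = (1 / (a - b) + (\<Sum>b\<in>A. 1 / (a - b))) * ((a - b) * poly h a)"
      using \<open>a - b \<noteq> 0\<close> by (simp add: IH field_simps)
    finally show ?case using insert.hyps by (simp add: h_def left_diff_distrib)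
  qed simp
  moreover have "poly (pderiv p) a = c * poly g a"
      "poly (pderiv (pderiv p)) a = 2 * c * poly (pderiv g) a"
    unfolding p g_def[symmetric] pderiv_mult pderiv_add
    by (simp_all add: pderiv_mult pderiv_add pderiv_diff pderiv_smult pderiv_pCons algebra_simps)
  ultimately show "poly (pderiv p) a \<noteq> 0"
    "poly (pderiv (pderiv p)) a = 2 * (\<Sum>b\<in>A. 1 / (a - b)) * poly (pderiv p) a"
    using g0 c by (simp_all add: algebra_simps)
qed

lemma poly_eq_prod_roots:
  fixes p :: "real poly"
  assumes "finite A" "degree p = card A" "\<And>x. x \<in> A \<Longrightarrow> poly p x = 0"
  shows "p = Polynomial.smult (lead_coeff p) (\<Prod>b\<in>A. [:- b, 1:])"
proof (rule poly_eqI_degree_lead_coeff[where A = A and n = "card A"])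
  have m: "degree (\<Prod>b\<in>A. [:- b, 1::real:]) = card A"
    by (subst degree_prod_eq_sum_degree) auto
  have "lead_coeff (\<Prod>b\<in>A. [:- b, 1::real:]) = 1"
    by (subst lead_coeff_prod) auto
  thus "poly.coeff p (card A) = poly.coeff (Polynomial.smult (lead_coeff p) (\<Prod>b\<in>A. [:- b, 1:])) (card A)"
    using assms m by simp
  show "degree (Polynomial.smult (lead_coeff p) (\<Prod>b\<in>A. [:- b, 1:])) \<le> card A"
    using m by simp
  show "poly p x = poly (Polynomial.smult (lead_coeff p) (\<Prod>b\<in>A. [:- b, 1:])) x" if "x \<in> A" for x
    using that assms by (simp add: poly_prod prod_zero)
qed (use assms in auto)

lemma ordered_zeros_inj: "ordered_zeros N p z \<Longrightarrow> inj_on z {..<N}"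
  unfolding ordered_zeros_def inj_on_def by (metis lessThan_iff less_irrefl linorder_neqE_nat)

text \<open>
  At a zero, the differential equation reads \<open>p'' = 2 x p'\<close>, whereas \<open>p'' / p'\<close> is twice the sum
  over the other zeros.
\<close>
theorem hermite_zeros_equilibrium:
  assumes H: "hermite_polys H" and z: "ordered_zeros N (H N) z" and i: "i < N"
  shows "(\<Sum>l\<in>{..<N} - {i}. 1 / (z i - z l)) = z i"
proof -
  have inj: "inj_on z {..<N}" using z by (rule ordered_zeros_inj)
  have deg: "H N \<noteq> 0" "degree (H N) = N"
    using H by (simp_all add: hermite_polys_def orthogonal_polys_def)
  have roots: "{x. poly (H N) x = 0} = z ` {..<N}"
    using z by (simp add: ordered_zeros_def)
  define A where "A = z ` ({..<N} - {i})"
  have A: "finite A" "z i \<notin> A" "z ` {..<N} = insert (z i) A"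
    using inj i by (auto simp: A_def inj_on_def)
  have "H N = Polynomial.smult (lead_coeff (H N)) (\<Prod>b\<in>z ` {..<N}. [:- b, 1:])"
    using deg roots inj by (intro poly_eq_prod_roots) (auto simp: card_image)
  hence fact: "H N = [:- z i, 1:] * Polynomial.smult (lead_coeff (H N)) (\<Prod>b\<in>A. [:- b, 1:])"
    using A by (simp add: mult.commute)
  have "lead_coeff (H N) \<noteq> 0" using deg(1) by (simp only: leading_coeff_0_iff not_False_eq_True)
  note st = stieltjes_sum_eq_log_deriv[OF A(1,2) fact this]
  have "poly (hermite_op (H N)) (z i) = 0"
    using hermite_differential_equation[OF H, of N] roots i by auto
  hence "poly (pderiv (pderiv (H N))) (z i) = 2 * z i * poly (pderiv (H N)) (z i)"
    by (simp add: hermite_op_def)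
  hence "(\<Sum>b\<in>A. 1 / (z i - b)) = z i" using st by simp
  moreover have "(\<Sum>b\<in>A. 1 / (z i - b)) = (\<Sum>l\<in>{..<N} - {i}. 1 / (z i - z l))"
    unfolding A_def by (subst sum.reindex) (auto intro: inj_on_subset[OF inj])
  ultimately show ?thesis by simp
qed

section \<open>The matrix as a triangular operator on polynomials\<close>

text \<open>
  \<open>cauchy_poly N z n\<close> and \<open>laplace_poly N z n\<close> interpolate, at the points \<open>z i\<close>, the sums
  \<open>\<Sum>l \<noteq> i. z l ^ n / (z i - z l)\<close> and \<open>\<Sum>l \<noteq> i. (z i ^ n - z l ^ n) / (z i - z l)\<^sup>2\<close>. The
  recursions come from replacing one factor \<open>z l\<close> of \<open>z l ^ Suc n\<close> by \<open>z i - (z i - z l)\<close>; the first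
  one starts from the electrostatic relation. Following the recursions, instead
  of interpolating, keeps control of the degrees.
\<close>
primrec cauchy_poly :: "nat \<Rightarrow> (nat \<Rightarrow> real) \<Rightarrow> nat \<Rightarrow> real poly" where
  "cauchy_poly N z 0 = [:0, 1:]"
| "cauchy_poly N z (Suc n) =
     pCons 0 (cauchy_poly N z n) + Polynomial.monom 1 n - [:\<Sum>l<N. z l ^ n:]"

primrec laplace_poly :: "nat \<Rightarrow> (nat \<Rightarrow> real) \<Rightarrow> nat \<Rightarrow> real poly" where
  "laplace_poly N z 0 = 0"
| "laplace_poly N z (Suc n) = pCons 0 (laplace_poly N z n) + cauchy_poly N z n"

text \<open>
  The linear extension of \<open>x ^ k \<mapsto> x ^ k + laplace_poly N z k\<close>.
\<close>
definition S_op :: "nat \<Rightarrow> (nat \<Rightarrow> real) \<Rightarrow> real poly \<Rightarrow> real poly" where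
  "S_op N z p = p + (\<Sum>k\<le>degree p. Polynomial.smult (poly.coeff p k) (laplace_poly N z k))"

lemma coeff_cauchy_poly:
  "j > n \<Longrightarrow> poly.coeff (cauchy_poly N z n) j = (if j = Suc n then 1 else 0)"
proof (induction n arbitrary: j)
  case 0
  thus ?case by (auto simp: coeff_pCons split: nat.splits)
next
  case (Suc n)
  then obtain k where "j = Suc k" "k > n" by (cases j) auto
  thus ?case using Suc.IH[of k] by (auto simp: coeff_pCons)
qed

lemma coeff_laplace_poly:
  "j \<ge> n \<Longrightarrow> poly.coeff (laplace_poly N z n) j = (if j = n then real n else 0)"
proof (induction n arbitrary: j)
  case (Suc n)
  then obtain k where "j = Suc k" "k \<ge> n" by (cases j) auto
  thus ?case using Suc.IH[of k] by (auto simp: coeff_pCons coeff_cauchy_poly)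
qed simp

text \<open>
  The operator is triangular for the degree filtration: its diagonal entries
  \<open>1, 2, 3, \<dots>\<close> will be the eigenvalues.
\<close>
lemma coeff_S_op:
  assumes "j \<ge> degree p"
  shows "poly.coeff (S_op N z p) j = real (j + 1) * poly.coeff p j"
proof -
  have "(\<Sum>k\<le>degree p. poly.coeff p k * poly.coeff (laplace_poly N z k) j)
      = (\<Sum>k\<le>degree p. if k = j then real j * poly.coeff p j else 0)"
    using assms by (intro sum.cong) (auto simp: coeff_laplace_poly)
  also have "\<dots> = real j * poly.coeff p j"
    using assms by (auto simp: coeff_eq_0)
  finally show ?thesis by (simp add: S_op_def coeff_sum algebra_simps)
qed

lemma S_mat_carrier [simp]: "S_mat N z \<in> carrier_mat N N"
  by (simp add: S_mat_def)

lemma S_mat_sym: "i < N \<Longrightarrow> j < N \<Longrightarrow> S_mat N z $$ (i, j) = S_mat N z $$ (j, i)"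
  by (auto simp: S_mat_def power2_commute)

lemma S_mat_apply:
  fixes f :: "nat \<Rightarrow> real"
  assumes "i < N"
  shows "(\<Sum>l<N. S_mat N z $$ (i, l) * f l)
    = f i + (\<Sum>l\<in>{..<N} - {i}. (f i - f l) / (z i - z l)\<^sup>2)"
proof -
  have "(\<Sum>l<N. S_mat N z $$ (i, l) * f l)
     = S_mat N z $$ (i, i) * f i + (\<Sum>l\<in>{..<N} - {i}. S_mat N z $$ (i, l) * f l)"
    using assms by (subst sum.remove[of _ i]) auto
  also have "(\<Sum>l\<in>{..<N} - {i}. S_mat N z $$ (i, l) * f l)
      = (\<Sum>l\<in>{..<N} - {i}. - (f l / (z i - z l)\<^sup>2))"
    using assms by (intro sum.cong) (auto simp: S_mat_def)
  also have "S_mat N z $$ (i, i) * f i = f i + (\<Sum>l\<in>{..<N} - {i}. f i / (z i - z l)\<^sup>2)"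
    using assms by (simp add: S_mat_def algebra_simps sum_distrib_left)
  finally show ?thesis
    by (simp add: sum_negf sum_subtractf diff_divide_distrib)
qed

text \<open>
  The Hermite polynomials enter only through this balance of forces between distinct points: each is
  repelled by the others with force \<open>1 / distance\<close> and confined by a linear force.
\<close>
locale equilibrium =
  fixes N :: nat and z :: "nat \<Rightarrow> real"
  assumes inj: "inj_on z {..<N}"
    and balance: "i < N \<Longrightarrow> (\<Sum>l\<in>{..<N} - {i}. 1 / (z i - z l)) = z i"
begin

lemma diff_nz: "i < N \<Longrightarrow> l \<in> {..<N} - {i} \<Longrightarrow> z i - z l \<noteq> 0"
  using inj by (auto simp: inj_on_def)

lemma poly_cauchy_poly:
  assumes i: "i < N"
  shows "poly (cauchy_poly N z n) (z i) = (\<Sum>l\<in>{..<N} - {i}. z l ^ n / (z i - z l))"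
proof (induction n)
  case 0
  show ?case using balance[OF i] by simp
next
  case (Suc n)
  have "(\<Sum>l\<in>{..<N} - {i}. z l ^ Suc n / (z i - z l))
      = (\<Sum>l\<in>{..<N} - {i}. z i * (z l ^ n / (z i - z l)) - z l ^ n)"
    using diff_nz[OF i] by (intro sum.cong) (auto simp: field_simps)
  also have "\<dots> = z i * poly (cauchy_poly N z n) (z i) - (\<Sum>l\<in>{..<N} - {i}. z l ^ n)"
    by (simp add: Suc.IH sum_subtractf sum_distrib_left)
  also have "(\<Sum>l\<in>{..<N} - {i}. z l ^ n) = (\<Sum>l<N. z l ^ n) - z i ^ n"
    using i by (subst sum_diff1) auto
  finally show ?case by (simp add: poly_monom)
qed

lemma poly_laplace_poly:
  assumes i: "i < N"
  shows "poly (laplace_poly N z n) (z i)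
    = (\<Sum>l\<in>{..<N} - {i}. (z i ^ n - z l ^ n) / (z i - z l)\<^sup>2)"
proof (induction n)
  case (Suc n)
  have "(\<Sum>l\<in>{..<N} - {i}. (z i ^ Suc n - z l ^ Suc n) / (z i - z l)\<^sup>2)
      = (\<Sum>l\<in>{..<N} - {i}. z i * ((z i ^ n - z l ^ n) / (z i - z l)\<^sup>2) + z l ^ n / (z i - z l))"
  proof (intro sum.cong refl)
    fix l assume "l \<in> {..<N} - {i}"
    hence "z i - z l \<noteq> 0" using diff_nz[OF i] by blast
    hence "z l ^ n / (z i - z l) = z l ^ n * (z i - z l) / (z i - z l)\<^sup>2"
      by (simp add: power2_eq_square)
    thus "(z i ^ Suc n - z l ^ Suc n) / (z i - z l)\<^sup>2
        = z i * ((z i ^ n - z l ^ n) / (z i - z l)\<^sup>2) + z l ^ n / (z i - z l)"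
      by (simp only: times_divide_eq_right add_divide_distrib[symmetric])
        (simp add: algebra_simps)
  qed
  thus ?case using Suc.IH poly_cauchy_poly[OF i, of n]
    by (simp add: sum.distrib sum_distrib_left)
qed simp

lemma poly_S_op:
  assumes i: "i < N"
  shows "poly (S_op N z p) (z i) = (\<Sum>l<N. S_mat N z $$ (i, l) * poly p (z l))"
proof -
  have "(\<Sum>k\<le>degree p. poly.coeff p k * poly (laplace_poly N z k) (z i))
      = (\<Sum>l\<in>{..<N} - {i}. \<Sum>k\<le>degree p.
           (poly.coeff p k * z i ^ k - poly.coeff p k * z l ^ k) / (z i - z l)\<^sup>2)"
    by (simp add: poly_laplace_poly[OF i] sum_distrib_left right_diff_distrib sum.swap[of _ "{..degree p}"])
  also have "\<dots> = (\<Sum>l\<in>{..<N} - {i}. (poly p (z i) - poly p (z l)) / (z i - z l)\<^sup>2)"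
    by (simp only: poly_altdef sum_subtractf[symmetric] sum_divide_distrib)
  finally show ?thesis
    by (simp add: S_mat_apply[OF i] S_op_def poly_sum)
qed

text \<open>
  Symmetry of the matrix, transported to polynomials of arbitrary degree with the (then possibly
  degenerate) inner product given by the values at the points.
\<close>
lemma S_op_sym:
  "(\<Sum>i<N. poly (S_op N z p * q) (z i)) = (\<Sum>i<N. poly (p * S_op N z q) (z i))"
proof -
  have "(\<Sum>i<N. poly (S_op N z p * q) (z i))
      = (\<Sum>i<N. \<Sum>l<N. S_mat N z $$ (i, l) * poly p (z l) * poly q (z i))"
    by (simp add: poly_S_op sum_distrib_right)
  also have "\<dots> = (\<Sum>l<N. \<Sum>i<N. S_mat N z $$ (l, i) * poly p (z l) * poly q (z i))"
    by (subst sum.swap) (auto intro!: sum.cong simp: S_mat_sym)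
  also have "\<dots> = (\<Sum>i<N. poly (p * S_op N z q) (z i))"
    by (simp add: poly_S_op sum_distrib_left mult_ac)
  finally show ?thesis .
qed

section \<open>Spectrum and eigenvectors\<close>

text \<open>
  The Vandermonde matrix \<open>V\<close> turns coefficient vectors into vectors of values, so it conjugates the
  matrix to the matrix \<open>R\<close> of \<open>S_op\<close> in the monomial basis, which is upper triangular. It is
  invertible because a nonzero polynomial of degree below \<open>N\<close> cannot vanish at \<open>N\<close> points.
\<close>
lemma eigenvalues: "{k. eigenvalue (S_mat N z) k} = real ` {1..N}"
proof -
  define V where "V = Matrix.mat N N (\<lambda>(i, j). z i ^ j)"
  define R where "R = Matrix.mat N N (\<lambda>(i, j). poly.coeff (S_op N z (Polynomial.monom 1 j)) i)"
  have V [simp]: "V \<in> carrier_mat N N" and R [simp]: "R \<in> carrier_mat N N"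
    by (simp_all add: V_def R_def)
  have SV: "S_mat N z * V = V * R"
  proof (rule eq_matI)
    fix i j assume "i < dim_row (V * R)" "j < dim_col (V * R)"
    hence ij: "i < N" "j < N" by (simp_all add: V_def R_def)
    have coeff0: "poly.coeff (S_op N z (Polynomial.monom 1 j)) k = 0" if "k \<ge> N" for k
      using that ij by (subst coeff_S_op) (auto simp: degree_monom_eq)
    have "degree (S_op N z (Polynomial.monom 1 j)) < N"
      using ij coeff0 by (intro degree_lessI) auto
    hence "poly (S_op N z (Polynomial.monom 1 j)) (z i)
        = (\<Sum>k<N. poly.coeff (S_op N z (Polynomial.monom 1 j)) k * z i ^ k)"
      unfolding poly_altdef by (intro sum.mono_neutral_left) (auto simp: coeff_eq_0)
    hence "(\<Sum>l<N. S_mat N z $$ (i, l) * z l ^ j)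
        = (\<Sum>k<N. poly.coeff (S_op N z (Polynomial.monom 1 j)) k * z i ^ k)"
      by (simp add: poly_S_op[OF ij(1)] poly_monom)
    thus "(S_mat N z * V) $$ (i, j) = (V * R) $$ (i, j)"
      using ij by (simp add: V_def R_def S_mat_def scalar_prod_def lessThan_atLeast0 mult.commute)
  qed (auto simp: V_def R_def S_mat_def)
  have "det V \<noteq> 0"
  proof
    assume "det V = 0"
    then obtain v where v: "v \<in> carrier_vec N" "v \<noteq> 0\<^sub>v N" "V *\<^sub>v v = 0\<^sub>v N"
      using det_0_iff_vec_prod_zero[OF V] by auto
    define p where "p = (\<Sum>j<N. Polynomial.monom (vec_index v j) j)"
    have cp: "poly.coeff p j = (if j < N then vec_index v j else 0)" for j
      by (simp add: p_def coeff_sum)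
    have "poly p (z i) = vec_index (V *\<^sub>v v) i" if "i < N" for i
      using that v(1) by (simp add: p_def poly_sum poly_monom V_def scalar_prod_def
          lessThan_atLeast0 mult.commute)
    hence root: "poly p x = 0" if "x \<in> z ` {..<N}" for x using v that by auto
    have "N > 0" using v by (cases N) auto
    hence "degree p < N" using cp by (intro degree_lessI) auto
    hence "p = 0"
      using root inj \<open>N > 0\<close> by (intro poly_eqI_degree[where A = "z ` {..<N}"]) (auto simp: card_image)
    hence "v = 0\<^sub>v N"
      using v(1) cp by (intro eq_vecI) (auto, metis coeff_0)
    thus False using v by simp
  qed
  from det_non_zero_imp_unit[OF V this, where b = "()"] obtain W where
    W: "W \<in> carrier_mat N N" "W * V = 1\<^sub>m N" "V * W = 1\<^sub>m N"
    by (auto simp: Units_def ring_mat_def)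
  have carrier: "{S_mat N z, R, V, W} \<subseteq> carrier_mat N N" using W(1) by simp
  have "S_mat N z = S_mat N z * (V * W)"
    using W right_mult_one_mat[OF S_mat_carrier] by simp
  also have "\<dots> = S_mat N z * V * W"
    using W(1) by (intro assoc_mult_mat[of _ N N _ N _ N, symmetric]) auto
  also have "\<dots> = V * R * W" by (simp only: SV)
  finally have "similar_mat (S_mat N z) R"
    by (rule similar_matI[OF carrier W(3,2)])
  hence "char_poly (S_mat N z) = char_poly R" by (rule char_poly_similar)
  also have "\<dots> = (\<Prod>a\<leftarrow>diag_mat R. [:- a, 1:])"
  proof (rule char_poly_upper_triangular[OF R])
    show "upper_triangular R"
      by (rule upper_triangularI) (auto simp: R_def coeff_S_op degree_monom_eq)
  qed
  also have "diag_mat R = map (\<lambda>j. real (j + 1)) [0..<N]"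
    by (auto simp: diag_mat_def R_def coeff_S_op degree_monom_eq)
  finally have "eigenvalue (S_mat N z) k \<longleftrightarrow> (\<exists>j<N. k = real (j + 1))" for k
    by (subst eigenvalue_root_char_poly[of _ N]) (auto simp: poly_prod_list prod_list_zero_iff)
  hence "{k. eigenvalue (S_mat N z) k} = (\<lambda>j. real (j + 1)) ` {..<N}" by auto
  also have "\<dots> = real ` Suc ` {..<N}" by (simp only: image_image Suc_eq_plus1)
  also have "Suc ` {..<N} = {1..N}" by (simp add: image_Suc_lessThan)
  finally show ?thesis .
qed

lemma integral_empirical_measure:
  assumes "N > 0"
  shows "integral\<^sup>L (empirical_measure N z) f = (\<Sum>i<N. f (z i)) / real N"
  using assms unfolding empirical_measure_def
  by (subst integral_map_pmf, subst integral_pmf_of_set) auto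

text \<open>
  The factor \<open>1 / N\<close> of the empirical measure does not affect orthogonality, so the inner product
  used here is the plain sum over the points. The defect then has square sum zero over the points,
  so it vanishes at each of them.
\<close>
lemma dual_polys_eigen:
  assumes P: "dual_polys N z P" and n: "n < N" and i: "i < N"
  shows "(\<Sum>l<N. S_mat N z $$ (i, l) * poly (P n) (z l)) = real (n + 1) * poly (P n) (z i)"
proof -
  define E where "E = (\<lambda>p. \<Sum>i<N. poly p (z i))"
  define r where "r = S_op N z (P n) - Polynomial.smult (real (n + 1)) (P n)"
  have orth: "orthogonal_polys (empirical_measure N z) {..<N} P"
    using P by (simp add: dual_polys_def)
  have "E (r * r) = 0"
  proof (rule orthogonal_poly_eigen_defect_null[where L = "S_op N z" and p = P and n = n
        and lam = "\<lambda>k. real (k + 1)", OF _ _ _ _ _ _ _ r_def])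
    show "E (p + q) = E p + E q" for p q by (simp add: E_def sum.distrib)
    show "E (Polynomial.smult c q) = c * E q" for c q by (simp add: E_def sum_distrib_left)
    show "degree (S_op N z q) \<le> degree q" for q
      by (rule degree_le) (simp add: coeff_S_op coeff_eq_0)
    show "poly.coeff (S_op N z q) (degree q) = real (degree q + 1) * lead_coeff q" for q
      by (simp add: coeff_S_op)
    show "E (S_op N z q * s) = E (q * S_op N z s)" for q s
      unfolding E_def by (rule S_op_sym)
    show "P m \<noteq> 0 \<and> degree (P m) = m" if "m \<le> n" for m
      using orth that n by (simp add: orthogonal_polys_def)
    show "E (P n * P m) = 0" if "m < n" for m
      using orth that n by (simp add: orthogonal_polys_def integral_empirical_measure E_def)
  qed
  hence "\<forall>i\<in>{..<N}. poly (r * r) (z i) = 0"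
    unfolding E_def by (subst (asm) sum_nonneg_eq_0_iff) auto
  hence "poly r (z i) = 0" using i by simp
  thus ?thesis using poly_S_op[OF i, of "P n"] by (simp add: r_def)
qed

lemma dual_polys_orthonormal:
  assumes P: "dual_polys N z P" and "m < N" "n < N"
  shows "(\<Sum>i<N. poly (P m) (z i) * poly (P n) (z i)) = (if m = n then 1 else 0)"
  using assms
  by (auto simp: dual_polys_def orthogonal_polys_def integral_empirical_measure power2_eq_square)

lemma T_mat_carrier [simp]: "T_mat N z P \<in> carrier_mat N N"
  by (simp add: T_mat_def)

lemma T_mat_orthogonal:
  assumes "dual_polys N z P"
  shows "transpose_mat (T_mat N z P) * T_mat N z P = 1\<^sub>m N"
    and "T_mat N z P * transpose_mat (T_mat N z P) = 1\<^sub>m N"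
proof -
  show *: "transpose_mat (T_mat N z P) * T_mat N z P = 1\<^sub>m N"
    using dual_polys_orthonormal[OF assms]
    by (intro eq_matI) (auto simp: T_mat_def scalar_prod_def lessThan_atLeast0)
  show "T_mat N z P * transpose_mat (T_mat N z P) = 1\<^sub>m N"
    by (rule mat_mult_left_right_inverse[OF _ _ *]) auto
qed

lemma S_mat_diagonalisation:
  assumes "dual_polys N z P"
  shows "S_mat N z = T_mat N z P * mat_diag N (\<lambda>j. real (j + 1)) * transpose_mat (T_mat N z P)"
proof -
  have ST: "S_mat N z * T_mat N z P = T_mat N z P * mat_diag N (\<lambda>j. real (j + 1))"
  proof (rule eq_matI)
    fix i j assume "i < dim_row (T_mat N z P * mat_diag N (\<lambda>j. real (j + 1)))"
      "j < dim_col (T_mat N z P * mat_diag N (\<lambda>j. real (j + 1)))"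
    hence "i < N" "j < N" by (simp_all add: T_mat_def mat_diag_def)
    thus "(S_mat N z * T_mat N z P) $$ (i, j)
        = (T_mat N z P * mat_diag N (\<lambda>j. real (j + 1))) $$ (i, j)"
      using dual_polys_eigen[OF assms, of j i]
      by (subst mat_diag_mult_right[of _ N])
        (auto simp: T_mat_def S_mat_def scalar_prod_def lessThan_atLeast0 mult.commute)
  qed (auto simp: T_mat_def S_mat_def mat_diag_def)
  have "S_mat N z = S_mat N z * (T_mat N z P * transpose_mat (T_mat N z P))"
    using T_mat_orthogonal[OF assms] right_mult_one_mat[OF S_mat_carrier] by simp
  also have "\<dots> = S_mat N z * T_mat N z P * transpose_mat (T_mat N z P)"
    by (rule assoc_mult_mat[of _ N N _ N _ N, symmetric]) auto
  finally show ?thesis by (simp only: ST)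
qed

lemma dual_polys_eigenvector:
  assumes "dual_polys N z P" and n: "n < N"
  shows "eigenvector (S_mat N z) (Matrix.vec N (\<lambda>i. poly (P n) (z i))) (real (n + 1))"
proof -
  let ?v = "Matrix.vec N (\<lambda>i. poly (P n) (z i))"
  have "?v \<noteq> 0\<^sub>v N"
  proof
    assume v: "?v = 0\<^sub>v N"
    have "poly (P n) (z i) = 0" if "i < N" for i
      using arg_cong[OF v, of "\<lambda>v. vec_index v i"] that by simp
    thus False using dual_polys_orthonormal[OF assms(1) n n] by simp
  qed
  moreover have "S_mat N z *\<^sub>v ?v = real (n + 1) \<cdot>\<^sub>v ?v"
    using dual_polys_eigen[OF assms]
    by (intro eq_vecI) (auto simp: S_mat_def scalar_prod_def lessThan_atLeast0)
  ultimately show ?thesis by (simp add: eigenvector_def S_mat_def)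
qed

end

theorem theorem3p1:
  fixes N :: nat and H :: "nat \<Rightarrow> real poly" and z :: "nat \<Rightarrow> real"
  assumes "N \<ge> 2"
    and "hermite_polys H"
    and "ordered_zeros N (H N) z"
  shows "{k. eigenvalue (S_mat N z) k} = real ` {1..N} \<and>
    (\<forall>P. dual_polys N z P \<longrightarrow>
       (\<forall>n\<in>{1..N}. eigenvector (S_mat N z) (Matrix.vec N (\<lambda>i. poly (P (n - 1)) (z i))) (real n)) \<and>
       inverts_mat (T_mat N z P) (transpose_mat (T_mat N z P)) \<and>
       inverts_mat (transpose_mat (T_mat N z P)) (T_mat N z P) \<and>
       S_mat N z =
         T_mat N z P * mat_diag N (\<lambda>j. real (j + 1)) * transpose_mat (T_mat N z P))"
proof -
  interpret equilibrium N z
    using ordered_zeros_inj[OF assms(3)] hermite_zeros_equilibrium[OF assms(2,3)]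
    by unfold_locales
  have "eigenvector (S_mat N z) (Matrix.vec N (\<lambda>i. poly (P (n - 1)) (z i))) (real n)"
    if "dual_polys N z P" "n \<in> {1..N}" for P n
    using dual_polys_eigenvector[OF that(1), of "n - 1"] that(2) by auto
  moreover have "inverts_mat (T_mat N z P) (transpose_mat (T_mat N z P))"
    "inverts_mat (transpose_mat (T_mat N z P)) (T_mat N z P)" if "dual_polys N z P" for P
    using T_mat_orthogonal[OF that] by (simp_all add: inverts_mat_def T_mat_def)
  ultimately show ?thesis
    using eigenvalues S_mat_diagonalisation by auto
qed

end
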